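(* Let $G$ be any $P$ game with $h$ types of players, minimal winning quota $q$ and incidence matrix $A$. Then $A$ is non singular and its determinant is $$|A|=q\cdot(-1)^{h+1}.$$
   Context: **Games.** Let $N=\{1,\dots,n\}$ be a set of players. A simple game is a function $v:\mathcal P(N)\to\{0,1\}$; a coalition $S\subseteq N$ is winning if $v(S)=1$, and minimal winning if $v(S)=1$ and $v(T)=0$ for every $T\subsetneq S$. The game is constant sum if $v(S)+v(N\setminus S)=1$ for all $S$. A player is a dummy if it belongs to no minimal winning coalition, and a dictator if $v(\{j\})=1$; all games considered are free of dummies and dictators. A representation $(q;\mathbf w)$ of a weighted majority game consists of positive weights $w_1,\dots,w_n$ and a quota $q>\tfrac12 w(N)$ such that $v(S)=1\iff w(S)\ge q$, where $w(S)=\sum_{j\in S}w_j$. It is homogeneous if $w(S)=q$ for every minimal winning $S$; a game is a homogeneous weighted majority game if it has a homogeneous representation. Every constant sum homogeneous weighted majority game has a (unique) minimal homogeneous representation: a homogeneous representation with integer weights, minimum weight $1$, and $q=\frac{1+w(N)}{2}$. The minimal winning quota of the game is the $q$ of this representation, and its individual weights are the $w_j$ of this representation. Players are always numbered so that $1=w_1\le w_2\le\dots\le w_n$ (standard ordering). **$P$ games.** A $P$ game (Parsimonious game) is a constant sum homogeneous weighted majority game with $n>3$ non-dummy players having exactly $n$ minimal winning coalitions (the smallest possible number). Players with the same individual weight are of the same type; types are numbered $t=1,\dots,h$ in strictly increasing order of weight. It is known that $2\le h\le n-2$, that type $h$ contains exactly one player (the top player, $j=n$), and that the minimal winning coalitions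 are exactly $S_1,\dots,S_n$, where for $j<n$ of type $t$ the coalition $S_j$ consists of $j$ and all players of type $s>t$ with $s-t$ odd, and $S_n$ consists of all players of odd type. **Incidence matrix.** The incidence matrix of a $P$ game is the $n\times n$ binary matrix $A=(a_{ij})$ with $a_{ij}=1$ if $j\in S_i$ and $a_{ij}=0$ otherwise. *)

theory Defs
  imports Complex_Main "Jordan_Normal_Form.Determinant"
begin

text \<open>Players are the natural numbers \<open>1, \<dots>, n\<close>. A game is a function on sets of naturals of which
  only the values on subsets of \<open>{1..n}\<close> matter; a weight function likewise only matters on \<open>{1..n}\<close>.\<close>

definition simple_game :: "nat \<Rightarrow> (nat set \<Rightarrow> nat) \<Rightarrow> bool" where
  "simple_game n v \<longleftrightarrow> (\<forall>S \<subseteq> {1..n}. v S \<in> {0, 1})"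

definition minimal_winning :: "nat \<Rightarrow> (nat set \<Rightarrow> nat) \<Rightarrow> nat set \<Rightarrow> bool" where
  "minimal_winning n v S \<longleftrightarrow> S \<subseteq> {1..n} \<and> v S = 1 \<and> (\<forall>T. T \<subset> S \<longrightarrow> v T = 0)"

definition constant_sum :: "nat \<Rightarrow> (nat set \<Rightarrow> nat) \<Rightarrow> bool" where
  "constant_sum n v \<longleftrightarrow> (\<forall>S \<subseteq> {1..n}. v S + v ({1..n} - S) = 1)"

definition dummy :: "nat \<Rightarrow> (nat set \<Rightarrow> nat) \<Rightarrow> nat \<Rightarrow> bool" where
  "dummy n v j \<longleftrightarrow> (\<nexists>S. minimal_winning n v S \<and> j \<in> S)"

definition dictator :: "(nat set \<Rightarrow> nat) \<Rightarrow> nat \<Rightarrow> bool" where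
  "dictator v j \<longleftrightarrow> v {j} = 1"

definition representation ::
  "nat \<Rightarrow> (nat set \<Rightarrow> nat) \<Rightarrow> real \<Rightarrow> (nat \<Rightarrow> real) \<Rightarrow> bool" where
  "representation n v q w \<longleftrightarrow>
     (\<forall>j \<in> {1..n}. w j > 0) \<and> q > sum w {1..n} / 2 \<and>
     (\<forall>S \<subseteq> {1..n}. v S = 1 \<longleftrightarrow> sum w S \<ge> q)"

definition homogeneous_representation ::
  "nat \<Rightarrow> (nat set \<Rightarrow> nat) \<Rightarrow> real \<Rightarrow> (nat \<Rightarrow> real) \<Rightarrow> bool" where
  "homogeneous_representation n v q w \<longleftrightarrow>
     representation n v q w \<and> (\<forall>S. minimal_winning n v S \<longrightarrow> sum w S = q)"

definition minimal_homogeneous_representation ::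
  "nat \<Rightarrow> (nat set \<Rightarrow> nat) \<Rightarrow> real \<Rightarrow> (nat \<Rightarrow> real) \<Rightarrow> bool" where
  "minimal_homogeneous_representation n v q w \<longleftrightarrow>
     homogeneous_representation n v q w \<and>
     (\<forall>j \<in> {1..n}. w j \<in> \<int>) \<and> Min (w ` {1..n}) = 1 \<and> q = (1 + sum w {1..n}) / 2"

definition P_game :: "nat \<Rightarrow> (nat set \<Rightarrow> nat) \<Rightarrow> bool" where
  "P_game n v \<longleftrightarrow>
     n > 3 \<and> simple_game n v \<and> constant_sum n v \<and>
     (\<exists>q w. homogeneous_representation n v q w) \<and>
     (\<forall>j \<in> {1..n}. \<not> dummy n v j) \<and> (\<forall>j \<in> {1..n}. \<not> dictator v j) \<and>
     card {S. minimal_winning n v S} = n"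

text \<open>In the following definitions \<open>w\<close> gives the individual weights of the game, that is, the weights
  of its minimal homogeneous representation. The type of player \<open>j\<close> is the rank of \<open>w j\<close> among the
  distinct weights, so types run through \<open>1, \<dots>, h\<close> in increasing order of weight.\<close>

definition num_types :: "nat \<Rightarrow> (nat \<Rightarrow> real) \<Rightarrow> nat" where
  "num_types n w = card (w ` {1..n})"

definition player_type :: "nat \<Rightarrow> (nat \<Rightarrow> real) \<Rightarrow> nat \<Rightarrow> nat" where
  "player_type n w j = card {x \<in> w ` {1..n}. x \<le> w j}"

text \<open>The coalition \<open>S\<^sub>j\<close>. For a \<open>P\<close> game in standard ordering, \<open>S\<^sub>1, \<dots>, S\<^sub>n\<close> are exactly the minimal
  winning coalitions; this enumeration fixes the order of the rows of the incidence matrix, and hence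
  the sign of its determinant.\<close>

definition mw_coalition :: "nat \<Rightarrow> (nat \<Rightarrow> real) \<Rightarrow> nat \<Rightarrow> nat set" where
  "mw_coalition n w j =
     (if j = n then {i \<in> {1..n}. odd (player_type n w i)}
      else insert j {i \<in> {1..n}. player_type n w i > player_type n w j \<and>
                                 odd (player_type n w i - player_type n w j)})"

text \<open>Matrix indices start at \<open>0\<close> and players at \<open>1\<close>, hence the shift.\<close>

definition incidence_matrix :: "nat \<Rightarrow> (nat \<Rightarrow> real) \<Rightarrow> real mat" where
  "incidence_matrix n w =
     mat n n (\<lambda>(i, j). if Suc j \<in> mw_coalition n w (Suc i) then 1 else 0)"

end

theory Submission
  imports Defs
begin

text \<open>In the minimal homogeneous representation the minimal winning coalitions are exactly the
  coalitions of weight \<open>q\<close>, so the game can be replaced by its weights, and the hypothesis on the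
  game says that precisely \<open>n\<close> coalitions have weight \<open>q\<close>.
  
  The determinant needs only the equations \<open>w(S\<^sub>1) = \<dots> = w(S\<^sub>n) = q\<close>. Given them, multiply row
  \<open>i < n\<close> of the incidence matrix by \<open>(-1)\<^sup>t w\<^sub>i\<close>, where \<open>t\<close> is the type of \<open>i\<close>, and add all these
  multiples to the last row. Comparing the equation of player \<open>j\<close> with that of player \<open>1\<close> or \<open>n\<close>
  (according to the parity of the type of \<open>j\<close>) shows that the new last row is
  \<open>(0, \<dots>, 0, (-1)\<^bsup>h+1\<^esup> q)\<close> (\<open>signed_column_sum\<close>). The new matrix is upper triangular with all other
  diagonal entries \<open>1\<close>, hence the determinant.
  
  The equations themselves come from the minimality of the number \<open>n\<close>. Homogeneity makes greedy
  completion exact (\<open>greedy_fill\<close>): adding light players to a losing coalition in decreasing order of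
  weight hits the quota exactly at the moment the coalition becomes winning. With it one shows that
  the coalitions of weight \<open>q\<close> span \<open>\<real>\<^sup>n\<close> (\<open>exact_coalitions_span\<close>); as there are only \<open>n\<close> of them,
  they are linearly independent. The independence is used through one consequence
  (\<open>exchange_unique\<close>): if nonempty \<open>K\<close> and \<open>K'\<close> have equal weight, at most one coalition of weight \<open>q\<close>
  contains \<open>K\<close> and avoids \<open>K'\<close>, since two of them together with the results of swapping \<open>K\<close> for \<open>K'\<close>
  would satisfy a linear relation.
  
  Whenever a greedy completion is not the one predicted, it creates a second context for some
  exchange. This yields \<open>w\<^sub>n + w\<^sub>n\<^sub>-\<^sub>1 = q\<close> with \<open>w\<^sub>n\<^sub>-\<^sub>1 < w\<^sub>n\<close> (\<open>top_pair\<close>, \<open>top_strict\<close>), and from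
  there a descent through the types gives \<open>w(S\<^sub>j) = q\<close> for every player \<open>j < n\<close> (\<open>descend_type\<close>);
  at type \<open>1\<close> the same completion gives \<open>w(S\<^sub>n) = q\<close>.\<close>

section \<open>Homogeneous integer weights\<close>

lemma Ints_less_imp_le_diff_1:
  assumes "x \<in> \<int>" "y \<in> \<int>" "x < (y::real)"
  shows "x \<le> y - 1"
proof -
  obtain a b where "x = of_int a" "y = of_int b" using assms(1,2) by (auto elim!: Ints_cases)
  then show ?thesis using assms(3) by simp
qed

text \<open>The weights of a constant sum homogeneous game in standard ordering, without the game:
  homogeneity says that every winning coalition contains one of weight exactly \<open>q\<close>.\<close>

locale homogeneous_weights =
  fixes n :: nat and w :: "nat \<Rightarrow> real" and q :: real
  assumes weight_mono: "mono_on {1..n} w"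
    and weight_Ints: "\<And>j. j \<in> {1..n} \<Longrightarrow> w j \<in> \<int>"
    and weight_ge_1: "\<And>j. j \<in> {1..n} \<Longrightarrow> 1 \<le> w j"
    and weight_first: "w 1 = 1"
    and n_pos: "1 \<le> n"
    and total_weight: "sum w {1..n} = 2 * q - 1"
    and homogeneous: "\<And>X. X \<subseteq> {1..n} \<Longrightarrow> q \<le> sum w X \<Longrightarrow> \<exists>Y\<subseteq>X. sum w Y = q"
    and first_nondummy: "\<exists>S\<subseteq>{1..n}. sum w S = q \<and> 1 \<in> S"
begin

definition exact_coalitions :: "nat set set" where
  "exact_coalitions = {S. S \<subseteq> {1..n} \<and> sum w S = q}"

lemma exactD:
  assumes "S \<in> exact_coalitions"
  shows "S \<subseteq> {1..n}" "sum w S = q" "finite S"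
  using assms finite_subset[of S "{1..n}"] by (auto simp: exact_coalitions_def)

lemma finite_exact_coalitions: "finite exact_coalitions"
  by (rule finite_subset[of _ "Pow {1..n}"]) (auto simp: exact_coalitions_def)

lemma weight_le: "i \<in> {1..n} \<Longrightarrow> j \<in> {1..n} \<Longrightarrow> i \<le> j \<Longrightarrow> w i \<le> w j"
  using weight_mono by (auto simp: mono_on_def)

lemma weight_pos: "j \<in> {1..n} \<Longrightarrow> 0 < w j"
  using weight_ge_1[of j] by simp

lemma sum_weight_mono: "A \<subseteq> B \<Longrightarrow> B \<subseteq> {1..n} \<Longrightarrow> sum w A \<le> sum w B"
  by (rule sum_mono2) (auto intro: finite_subset intro!: less_imp_le[OF weight_pos])

lemma sum_weight_Diff: "A \<subseteq> B \<Longrightarrow> B \<subseteq> {1..n} \<Longrightarrow> sum w (B - A) = sum w B - sum w A"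
  by (rule sum_diff) (auto intro: finite_subset)

lemma sum_weight_Un:
  "A \<subseteq> {1..n} \<Longrightarrow> B \<subseteq> {1..n} \<Longrightarrow> A \<inter> B = {} \<Longrightarrow> sum w (A \<union> B) = sum w A + sum w B"
  by (rule sum.union_disjoint) (auto intro: finite_subset)

lemma sum_weight_insert:
  "A \<subseteq> {1..n} \<Longrightarrow> j \<notin> A \<Longrightarrow> sum w (insert j A) = w j + sum w A"
  by (rule sum.insert) (auto intro: finite_subset)

lemma member_weight_le: "j \<in> B \<Longrightarrow> B \<subseteq> {1..n} \<Longrightarrow> w j \<le> sum w B"
  using sum_weight_mono[of "{j}" B] by auto

lemma sum_weight_psubset:
  assumes "A \<subset> B" "B \<subseteq> {1..n}"
  shows "sum w A + 1 \<le> sum w B"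
proof -
  obtain j where j: "j \<in> B" "j \<notin> A" using assms(1) by blast
  have "sum w (insert j A) \<le> sum w B" using assms j by (intro sum_weight_mono) auto
  moreover have "sum w (insert j A) = w j + sum w A"
    using assms j by (intro sum_weight_insert) auto
  ultimately show ?thesis using weight_ge_1[of j] j assms by auto
qed

lemma quota_pos: "1 \<le> q"
proof -
  have "w 1 \<le> sum w {1..n}" using n_pos by (intro member_weight_le) auto
  then show ?thesis using total_weight weight_first by simp
qed

text \<open>Add the players of \<open>F\<close> to \<open>P\<close>, heaviest first, and stop at the first winning coalition. The player
  \<open>k\<close> added last is a lightest one, so no proper subcoalition is winning; by homogeneity the weight
  is exactly \<open>q\<close>.\<close>

lemma greedy_fill:
  assumes P: "P \<subseteq> {1..n}" "sum w P < q"
    and F: "F \<subseteq> {1..n}" "P \<inter> F = {}" "q \<le> sum w P + sum w F"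
    and light: "\<And>p f. p \<in> P \<Longrightarrow> f \<in> F \<Longrightarrow> w f \<le> w p"
  shows "\<exists>k\<in>F. sum w P + sum w (F \<inter> {k..}) = q"
proof -
  have finF: "finite F" using F(1) by (rule finite_subset) simp
  define G where "G = {k \<in> F. q \<le> sum w P + sum w (F \<inter> {k..})}"
  have "F \<noteq> {}" using P F by auto
  then have "F \<inter> {Min F..} = F" using finF by auto
  then have "Min F \<in> G" using F finF \<open>F \<noteq> {}\<close> by (auto simp: G_def)
  moreover have finG: "finite G" using finF by (simp add: G_def)
  ultimately have kG: "Max G \<in> G" by (intro Max_in) auto
  define k where "k = Max G"
  have k: "k \<in> F" "q \<le> sum w P + sum w (F \<inter> {k..})" using kG by (auto simp: G_def k_def)
  \<comment> \<open>Stopping one player earlier leaves a losing coalition, by maximality of \<open>k\<close>.\<close>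
  have below: "sum w P + sum w (F \<inter> {k<..}) < q"
  proof (cases "F \<inter> {k<..} = {}")
    case True
    then show ?thesis using P by simp
  next
    case False
    define m where "m = Min (F \<inter> {k<..})"
    have m: "m \<in> F \<inter> {k<..}" unfolding m_def using False finF by (intro Min_in) auto
    have "F \<inter> {m..} = F \<inter> {k<..}" using m finF by (auto simp: m_def)
    moreover have "m \<notin> G" using m Max_ge[OF finG, of m] by (auto simp: k_def)
    ultimately show ?thesis using m by (auto simp: G_def)
  qed
  define X where "X = P \<union> F \<inter> {k..}"
  have XN: "X \<subseteq> {1..n}" using P F by (auto simp: X_def)
  have wX: "sum w X = sum w P + sum w (F \<inter> {k..})"
    unfolding X_def using P F by (intro sum_weight_Un) auto
  have wk: "sum w (F \<inter> {k..}) = w k + sum w (F \<inter> {k<..})"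
  proof -
    have "F \<inter> {k..} = insert k (F \<inter> {k<..})" using k by auto
    then show ?thesis using F sum_weight_insert[of "F \<inter> {k<..}" k] by auto
  qed
  obtain Y where Y: "Y \<subseteq> X" "sum w Y = q" using homogeneous[OF XN] k wX by auto
  have "Y = X"
  proof (rule ccontr)
    assume "Y \<noteq> X"
    then obtain z where z: "z \<in> X" "z \<notin> Y" using Y by auto
    have "w k \<le> w z"
      using z light[of z k] weight_le[of k z] k(1) subsetD[OF F(1)] unfolding X_def by blast
    moreover have "w z + sum w Y \<le> sum w X"
      using sum_weight_mono[of "insert z Y" X] sum_weight_insert[of Y z] Y z XN by auto
    ultimately show False using Y wX wk below by linarith
  qed
  then show ?thesis using k Y wX by auto
qed

text \<open>Completing \<open>S - I\<close> greedily from \<open>F\<close> restores the weight removed.\<close>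

lemma replace_by_lighter:
  assumes S: "S \<in> exact_coalitions" and I: "I \<subseteq> S" "I \<noteq> {}"
    and F: "F \<subseteq> {1..n}" "S \<inter> F = {}" "sum w I \<le> sum w F"
    and light: "\<And>p f. p \<in> S - I \<Longrightarrow> f \<in> F \<Longrightarrow> w f \<le> w p"
  shows "\<exists>k\<in>F. sum w (F \<inter> {k..}) = sum w I"
proof -
  have SN: "S \<subseteq> {1..n}" "sum w S = q" using exactD[OF S] by auto
  have d: "sum w (S - I) = q - sum w I" using sum_weight_Diff[of I S] I SN by auto
  have "sum w {} + 1 \<le> sum w I" using I SN by (intro sum_weight_psubset) auto
  then have "\<exists>k\<in>F. sum w (S - I) + sum w (F \<inter> {k..}) = q"
    using SN F I light d by (intro greedy_fill) auto
  then show ?thesis using d by auto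
qed

lemma exact_swap:
  assumes S: "S \<in> exact_coalitions" and K: "K \<subseteq> S"
    and K': "K' \<subseteq> {1..n}" "S \<inter> K' = {}" "sum w K' = sum w K"
  shows "S - K \<union> K' \<in> exact_coalitions"
proof -
  have SN: "S \<subseteq> {1..n}" "sum w S = q" using exactD[OF S] by auto
  have "sum w (S - K \<union> K') = sum w (S - K) + sum w K'"
    using SN K K' by (intro sum_weight_Un) auto
  then show ?thesis using sum_weight_Diff[of K S] K K' SN by (auto simp: exact_coalitions_def)
qed

lemma exact_Un:
  assumes "A \<subseteq> {1..n}" "B \<subseteq> {1..n}" "A \<inter> B = {}" "sum w A + sum w B = q"
  shows "A \<union> B \<in> exact_coalitions"
  using assms sum_weight_Un[OF assms(1-3)] by (simp add: exact_coalitions_def)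

text \<open>The membership of \<open>i\<close> is not forced by that of the heavier players: \<open>P\<close> is losing, and becomes
  winning both with \<open>i\<close> and without \<open>i\<close> when lighter players are added. If a coalition \<open>S\<close> of
  weight \<open>q\<close> contains player \<open>1\<close> and omits \<open>i\<close>, its part above \<open>i\<close> is such a \<open>P\<close>. If \<open>S\<close> contains
  both, its complement together with player \<open>1\<close> has weight \<open>(q - 1) + 1 = q\<close> and omits \<open>i\<close>.\<close>

lemma split_at_player:
  assumes i: "1 < i" "i \<le> n"
  shows "\<exists>P\<subseteq>{i<..n}. sum w P < q \<and> q \<le> sum w P + sum w {1..<i}"
proof -
  obtain S where S: "S \<subseteq> {1..n}" "sum w S = q" "1 \<in> S" using first_nondummy by blast
  have "\<exists>S\<subseteq>{1..n}. sum w S = q \<and> 1 \<in> S \<and> i \<notin> S"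
  proof (cases "i \<in> S")
    case True
    have "sum w (insert 1 ({1..n} - S)) = w 1 + sum w ({1..n} - S)"
      using S by (intro sum_weight_insert) auto
    also have "\<dots> = q" using sum_weight_Diff[of S "{1..n}"] S total_weight weight_first by simp
    finally show ?thesis using True i n_pos by (intro exI[of _ "insert 1 ({1..n} - S)"]) auto
  qed (use S in auto)
  then obtain S where S: "S \<subseteq> {1..n}" "sum w S = q" "1 \<in> S" "i \<notin> S" by blast
  define P where "P = S \<inter> {i<..n}"
  have "{1..n} - {i} \<subseteq> {i<..n} \<union> {1..<i}" by auto
  then have "S = P \<union> S \<inter> {1..<i}" using S(1,4) unfolding P_def by blast
  moreover have "sum w (P \<union> S \<inter> {1..<i}) = sum w P + sum w (S \<inter> {1..<i})"
    using S by (intro sum_weight_Un) (auto simp: P_def)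
  moreover have "sum w (S \<inter> {1..<i}) \<le> sum w {1..<i}" using i by (intro sum_weight_mono) auto
  moreover have "w 1 \<le> sum w (S \<inter> {1..<i})" using i S by (intro member_weight_le) auto
  ultimately show ?thesis using S weight_first
    by (intro exI[of _ P]) (auto simp: P_def)
qed

text \<open>Otherwise the coalition \<open>P\<close> of the previous lemma would jump over \<open>q\<close> when \<open>i\<close> is added, although
  \<open>i\<close> is lightest in \<open>P \<union> {i}\<close>.\<close>

lemma weight_le_sum_of_lighter:
  assumes i: "1 < i" "i \<le> n"
  shows "w i \<le> sum w {1..<i}"
proof (rule ccontr)
  assume "\<not> w i \<le> sum w {1..<i}"
  moreover obtain P where P: "P \<subseteq> {i<..n}" "sum w P < q" "q \<le> sum w P + sum w {1..<i}"
    using split_at_player[OF i] by blast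
  moreover from calculation have "\<exists>k\<in>{i}. sum w P + sum w ({i} \<inter> {k..}) = q"
    using i by (intro greedy_fill weight_le) fastforce+
  ultimately show False by auto
qed

text \<open>Let \<open>u\<close> be orthogonal to all coalitions of weight \<open>q\<close>. Two completions of the same \<open>P\<close>, one with
  \<open>i\<close> and one without, express both \<open>u i\<close> and \<open>w i\<close> by the same combination of values at lighter
  players. Hence \<open>u = u\<^sub>1 w\<close>, and one coalition of weight \<open>q > 0\<close> forces \<open>u\<^sub>1 = 0\<close>.\<close>

lemma exact_coalitions_span:
  assumes u: "\<And>S. S \<in> exact_coalitions \<Longrightarrow> sum u S = (0::real)" and j: "j \<in> {1..n}"
  shows "u j = 0"
proof -
  have proportional: "i \<in> {1..n} \<Longrightarrow> u i = u 1 * w i" for i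
  proof (induction i rule: less_induct)
    case (less i)
    show ?case
    proof (cases "i = 1")
      case True
      then show ?thesis using weight_first by simp
    next
      case False
      then have i: "1 < i" "i \<le> n" using less.prems by auto
      have lower: "sum u K = u 1 * sum w K" if "K \<subseteq> {1..<i}" for K
        unfolding sum_distrib_left using that i by (intro sum.cong less.IH) auto
      obtain P where P: "P \<subseteq> {i<..n}" "sum w P < q" "q \<le> sum w P + sum w {1..<i}"
        using split_at_player[OF i] by blast
      have PN: "P \<subseteq> {1..n}" and finP: "finite P" using P(1) i by (auto intro: finite_subset)
      have below: "P \<inter> {1..i} = {}" using P(1) by force
      have light: "w f \<le> w p" if "p \<in> insert i P" "f \<in> {1..i}" for p f
        using that P i by (intro weight_le) fastforce+
      \<comment> \<open>\<open>K\<close> completes \<open>P\<close> without \<open>i\<close>, and \<open>M\<close> completes it together with \<open>i\<close>.\<close>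
      have "\<exists>k\<in>{1..<i}. sum w P + sum w ({1..<i} \<inter> {k..}) = q"
        using P PN i light by (intro greedy_fill) auto
      then obtain k where k: "sum w P + sum w ({1..<i} \<inter> {k..}) = q" by blast
      define K where "K = {1..<i} \<inter> {k..}"
      have K: "K \<subseteq> {1..<i}" "sum w P + sum w K = q" using k by (auto simp: K_def)
      have "\<exists>M\<subseteq>{1..<i}. sum w P + w i + sum w M = q"
      proof (cases "q \<le> sum w P + w i")
        case True
        then have "\<exists>k\<in>{i}. sum w P + sum w ({i} \<inter> {k..}) = q"
          using P PN i light by (intro greedy_fill) auto
        then show ?thesis by (intro exI[of _ "{}"]) auto
      next
        case False
        have e: "sum w (insert i P) = w i + sum w P" using P PN by (intro sum_weight_insert) auto
        have "\<exists>k\<in>{1..<i}. sum w (insert i P) + sum w ({1..<i} \<inter> {k..}) = q"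
          using P PN i light e False weight_pos[of i] by (intro greedy_fill) auto
        then obtain k where "sum w (insert i P) + sum w ({1..<i} \<inter> {k..}) = q" by blast
        then show ?thesis using e by (intro exI[of _ "{1..<i} \<inter> {k..}"]) auto
      qed
      then obtain M where M: "M \<subseteq> {1..<i}" "sum w P + w i + sum w M = q" by blast
      have finKM: "finite K" "finite M" using K M by (auto intro: finite_subset)
      have disj: "P \<inter> K = {}" "P \<inter> M = {}" "i \<notin> P \<union> M"
      proof -
        have "{1..<i} \<subseteq> {1..i}" "i \<in> {1..i}" "i \<notin> {1..<i}" using i by auto
        then show "P \<inter> K = {}" "P \<inter> M = {}" "i \<notin> P \<union> M"
          using below K(1) M(1) by blast+
      qed
      have "P \<union> K \<in> exact_coalitions"
        using K i by (intro exact_Un PN disj(1)) auto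
      moreover have "insert i (P \<union> M) \<in> exact_coalitions"
      proof -
        have MN: "M \<subseteq> {1..n}" using M i by auto
        then have "sum w (insert i (P \<union> M)) = q"
          using sum_weight_insert[of "P \<union> M" i] sum_weight_Un[of P M] PN M disj by auto
        then show ?thesis using PN MN i by (auto simp: exact_coalitions_def)
      qed
      ultimately have "sum u (P \<union> K) = 0" "sum u (insert i (P \<union> M)) = 0" using u by auto
      then have "sum u P + sum u K = 0" "u i + (sum u P + sum u M) = 0"
        using finP finKM disj by (auto simp: sum.union_disjoint)
      then have "u i = u 1 * (sum w K - sum w M)"
        using lower K M by (simp add: algebra_simps)
      also have "sum w K - sum w M = w i" using K M by simp
      finally show ?thesis .
    qed
  qed
  obtain S where S: "S \<in> exact_coalitions"
    using first_nondummy by (auto simp: exact_coalitions_def)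
  have "0 = sum u S" using u[OF S] by simp
  also have "\<dots> = u 1 * sum w S"
    unfolding sum_distrib_left using exactD[OF S] by (intro sum.cong proportional) auto
  finally have "u 1 = 0" using exactD[OF S] quota_pos by auto
  then show ?thesis using proportional[OF j] by simp
qed

text \<open>A spanning family of \<open>n\<close> vectors in \<open>\<real>\<^sup>n\<close> is a basis; here via the determinant of the square
  matrix whose rows are the coalitions.\<close>

lemma exact_coalitions_independent:
  assumes card: "card exact_coalitions = n"
    and f: "\<And>j. j \<in> {1..n} \<Longrightarrow> (\<Sum>S\<in>exact_coalitions. f S * of_bool (j \<in> S)) = (0::real)"
    and S: "S \<in> exact_coalitions"
  shows "f S = 0"
proof -
  obtain e where e: "bij_betw e {0..<n} exact_coalitions"
    using ex_bij_betw_nat_finite[OF finite_exact_coalitions] card by auto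
  define M :: "real mat" where "M = mat n n (\<lambda>(i, j). of_bool (Suc j \<in> e i))"
  have M: "M \<in> carrier_mat n n" by (simp add: M_def)
  have kernel: "x = 0\<^sub>v n" if x: "x \<in> carrier_vec n" "M *\<^sub>v x = 0\<^sub>v n" for x
  proof -
    have "sum (\<lambda>j. x $ (j - 1)) T = 0" if T: "T \<in> exact_coalitions" for T
    proof -
      obtain i where i: "i < n" "e i = T"
        using bij_betw_imp_surj_on[OF e] T by (metis atLeastLessThan_iff imageE)
      have TN: "T \<subseteq> {1..n}" using exactD[OF T] by simp
      have "(M *\<^sub>v x) $ i = (\<Sum>j = 0..<n. of_bool (Suc j \<in> T) * x $ j)"
        using i x(1) by (auto simp: M_def scalar_prod_def intro!: sum.cong)
      also have "\<dots> = (\<Sum>j = 1..n. of_bool (j \<in> T) * x $ (j - 1))"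
        by (rule sum.reindex_bij_witness[of _ "\<lambda>j. j - 1" Suc]) auto
      also have "\<dots> = (\<Sum>j\<in>T. x $ (j - 1))"
        using TN by (intro sum.mono_neutral_cong_right) auto
      finally show ?thesis using x i by simp
    qed
    then have "x $ (j - 1) = 0" if "j \<in> {1..n}" for j
      using exact_coalitions_span[of "\<lambda>j. x $ (j - 1)" j] that by auto
    from this[of "Suc i" for i] show ?thesis using x by (intro eq_vecI) auto
  qed
  then have "det M \<noteq> 0" using det_0_iff_vec_prod_zero[OF M] by blast
  then have "det M\<^sup>T \<noteq> 0" using det_transpose[OF M] by simp
  moreover define y where "y = vec n (\<lambda>i. f (e i))"
  have "M\<^sup>T *\<^sub>v y = 0\<^sub>v n"
  proof (rule eq_vecI)
    fix j assume j: "j < dim_vec (0\<^sub>v n)"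
    then have "(M\<^sup>T *\<^sub>v y) $ j = (\<Sum>i = 0..<n. of_bool (Suc j \<in> e i) * f (e i))"
      using M by (simp add: M_def y_def scalar_prod_def)
    also have "\<dots> = (\<Sum>S\<in>exact_coalitions. of_bool (Suc j \<in> S) * f S)"
      by (rule sum.reindex_bij_betw[OF e])
    also have "\<dots> = 0" using f[of "Suc j"] j by (simp add: mult.commute)
    finally show "(M\<^sup>T *\<^sub>v y) $ j = 0\<^sub>v n $ j" using j by simp
  qed (use M in auto)
  moreover have "M\<^sup>T \<in> carrier_mat n n" using M by simp
  ultimately have "y = 0\<^sub>v n"
    using det_0_iff_vec_prod_zero[of "M\<^sup>T" n] by (metis vec_carrier y_def)
  moreover obtain i where i: "i < n" "e i = S"
    using bij_betw_imp_surj_on[OF e] S by (metis atLeastLessThan_iff imageE)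
  ultimately show ?thesis using index_vec[of i n "\<lambda>i. f (e i)"] by (simp add: y_def)
qed

text \<open>With \<open>B\<close> and \<open>B'\<close> obtained from \<open>S\<close> and \<open>S'\<close> by swapping \<open>K\<close> for \<open>K'\<close>, the indicator vectors
  satisfy \<open>S + B' = S' + B\<close>. If \<open>S \<noteq> S'\<close> the four coalitions are distinct and this contradicts
  independence.\<close>

lemma exchange_unique:
  assumes card: "card exact_coalitions = n"
    and S: "S \<in> exact_coalitions" and S': "S' \<in> exact_coalitions"
    and K: "K \<subseteq> S" "K \<subseteq> S'" "K \<noteq> {}"
    and K': "K' \<subseteq> {1..n}" "S \<inter> K' = {}" "S' \<inter> K' = {}" "sum w K' = sum w K"
  shows "S = S'"
proof (rule ccontr)
  assume neq: "S \<noteq> S'"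
  define B where "B = S - K \<union> K'"
  define B' where "B' = S' - K \<union> K'"
  have B: "B \<in> exact_coalitions" "B' \<in> exact_coalitions"
    unfolding B_def B'_def using S S' K K' by (auto intro!: exact_swap)
  obtain x where x: "x \<in> K" using K by blast
  have xK': "x \<notin> K'" using x K K' by blast
  have d: "S \<noteq> B" "S \<noteq> B'" "S' \<noteq> B" "S' \<noteq> B'"
    using x xK' K by (auto simp: B_def B'_def)
  have "B \<noteq> B'"
  proof
    assume "B = B'"
    then have "S - K = S' - K" using K' by (auto simp: B_def B'_def)
    then show False using neq K by blast
  qed
  note d = d this neq
  define f :: "nat set \<Rightarrow> real" where
    "f X = of_bool (X = S) + of_bool (X = B') - of_bool (X = S') - of_bool (X = B)" for X
  have "f S = 0"
  proof (rule exact_coalitions_independent[OF card _ S])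
    fix j
    have "(\<Sum>X\<in>exact_coalitions. f X * of_bool (j \<in> X)) =
        (\<Sum>X\<in>{S, B', S', B}. f X * of_bool (j \<in> X))"
      using S S' B finite_exact_coalitions
      by (intro sum.mono_neutral_right) (auto simp: f_def)
    also have "\<dots> = of_bool (j \<in> S) + of_bool (j \<in> B') - of_bool (j \<in> S') - of_bool (j \<in> B)"
      using d by (simp add: f_def)
    also have "\<dots> = 0" using K K' by (auto simp: B_def B'_def)
    finally show "(\<Sum>X\<in>exact_coalitions. f X * of_bool (j \<in> X)) = 0" .
  qed
  then show False using d by (simp add: f_def)
qed


section \<open>Types of players\<close>

abbreviation "ty \<equiv> player_type n w"
abbreviation "h \<equiv> num_types n w"

lemma type_less_iff:
  assumes "i \<in> {1..n}" "j \<in> {1..n}"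
  shows "ty i < ty j \<longleftrightarrow> w i < w j"
proof -
  let ?V = "\<lambda>i. {x \<in> w ` {1..n}. x \<le> w i}"
  have lt: "ty i < ty j" if "j \<in> {1..n}" "w i < w j" for i j
  proof -
    have "w j \<in> ?V j" "w j \<notin> ?V i" "?V i \<subseteq> ?V j" using that by auto
    then have "?V i \<subset> ?V j" by blast
    then show ?thesis unfolding player_type_def by (intro psubset_card_mono) auto
  qed
  have "ty j \<le> ty i" if "\<not> w i < w j"
    unfolding player_type_def using that by (intro card_mono) auto
  then show ?thesis using lt[of j i] assms by (meson not_le)
qed

lemma type_eq_iff:
  assumes "i \<in> {1..n}" "j \<in> {1..n}"
  shows "ty i = ty j \<longleftrightarrow> w i = w j"
  using type_less_iff[OF assms] type_less_iff[OF assms(2,1)] by (metis linorder_neqE less_irrefl)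

lemma type_mono: "i \<in> {1..n} \<Longrightarrow> j \<in> {1..n} \<Longrightarrow> i \<le> j \<Longrightarrow> ty i \<le> ty j"
  using type_less_iff[of j i] weight_le[of i j] by (meson not_le)

lemma type_surj: "ty ` {1..n} = {1..h}"
proof (rule card_subset_eq)
  show "ty ` {1..n} \<subseteq> {1..h}"
  proof clarify
    fix i assume i: "i \<in> {1..n}"
    have "w i \<in> {x \<in> w ` {1..n}. x \<le> w i}" using i by simp
    then have "0 < card {x \<in> w ` {1..n}. x \<le> w i}" by (subst card_gt_0_iff) auto
    moreover have "ty i \<le> h"
      unfolding player_type_def num_types_def by (rule card_mono) auto
    ultimately show "ty i \<in> {1..h}" by (auto simp: player_type_def)
  qed
  have "bij_betw (\<lambda>x. card {y \<in> w ` {1..n}. y \<le> x}) (w ` {1..n}) (ty ` {1..n})"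
    unfolding bij_betw_def
  proof
    show "inj_on (\<lambda>x. card {y \<in> w ` {1..n}. y \<le> x}) (w ` {1..n})"
      using type_eq_iff by (auto simp: inj_on_def player_type_def)
  qed (auto simp: image_image player_type_def)
  then show "card (ty ` {1..n}) = card {1..h}" by (auto simp: num_types_def dest: bij_betw_same_card)
qed simp

lemma type_bounds: "i \<in> {1..n} \<Longrightarrow> 1 \<le> ty i \<and> ty i \<le> h"
  using type_surj by auto

lemma type_attained: "1 \<le> t \<Longrightarrow> t \<le> h \<Longrightarrow> \<exists>i\<in>{1..n}. ty i = t"
  using type_surj by (metis atLeastAtMost_iff imageE)

lemma type_last: "ty n = h"
  using type_attained[of h] type_bounds[of n] type_mono[of _ n] n_pos
  by (metis atLeastAtMost_iff le_antisym le_trans order_refl)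

lemma type_first: "ty 1 = 1"
  using type_attained[of 1] type_bounds[of 1] type_mono[of 1] n_pos
  by (metis atLeastAtMost_iff le_antisym le_trans order_refl)

text \<open>For \<open>j < n\<close> of type \<open>t\<close> the coalition \<open>S\<^sub>j\<close> is \<open>{j} \<union> odd_above t\<close>, and \<open>S\<^sub>n\<close> is \<open>even_above 1\<close>.\<close>

definition odd_above :: "nat \<Rightarrow> nat set" where
  "odd_above t = {i \<in> {1..n}. t < ty i \<and> odd (ty i - t)}"

definition even_above :: "nat \<Rightarrow> nat set" where
  "even_above t = {i \<in> {1..n}. t \<le> ty i \<and> even (ty i - t)}"

definition types_below :: "nat \<Rightarrow> nat set" where
  "types_below t = {i \<in> {1..n}. ty i < t}"

lemma above_subset: "odd_above t \<subseteq> {1..n}" "even_above t \<subseteq> {1..n}" "types_below t \<subseteq> {1..n}"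
  by (auto simp: odd_above_def even_above_def types_below_def)

lemma odd_above_pred: "1 \<le> t \<Longrightarrow> odd_above (t - 1) = even_above t"
  by (auto simp: odd_above_def even_above_def)

lemma above_total:
  "sum w (odd_above t) + sum w (even_above t) + sum w (types_below t) = 2 * q - 1"
proof -
  have "{1..n} = odd_above t \<union> even_above t \<union> types_below t"
    by (auto simp: odd_above_def even_above_def types_below_def)
  moreover have "sum w (odd_above t \<union> even_above t) = sum w (odd_above t) + sum w (even_above t)"
    by (intro sum_weight_Un) (auto simp: odd_above_def even_above_def)
  moreover have "sum w (odd_above t \<union> even_above t \<union> types_below t) =
      sum w (odd_above t \<union> even_above t) + sum w (types_below t)"
    by (intro sum_weight_Un) (auto simp: odd_above_def even_above_def types_below_def)
  ultimately show ?thesis using total_weight by simp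
qed

end

section \<open>The structure of parsimonious weights\<close>

locale parsimonious_weights = homogeneous_weights +
  assumes n_gt_3: "3 < n"
    and no_dictator: "\<And>j. j \<in> {1..n} \<Longrightarrow> w j < q"
    and card_exact: "card exact_coalitions = n"
begin

text \<open>The heaviest players form a coalition \<open>S = {k..n}\<close> of weight \<open>q\<close>. If it had a third member, \<open>n\<close>
  could be replaced in \<open>S\<close> by a set \<open>A\<close> of players below \<open>k\<close>, and \<open>n - 1\<close> could afterwards be replaced
  by further such players. The latter exchange would then be possible both in \<open>S\<close> and in the modified
  coalition \<open>B\<close>.\<close>

lemma top_pair: "w n + w (n - 1) = q"
proof -
  have "\<exists>k\<in>{1..n}. sum w {} + sum w ({1..n} \<inter> {k..}) = q"
    using quota_pos total_weight by (intro greedy_fill) auto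
  then obtain k where k: "k \<in> {1..n}" "sum w ({1..n} \<inter> {k..}) = q" by auto
  have "{1..n} \<inter> {k..} = {k..n}" using k by auto
  then have wS: "sum w {k..n} = q" using k by simp
  then have "k \<noteq> n" using no_dictator[of n] n_gt_3 by auto
  have "k = n - 1"
  proof (rule ccontr)
    assume "k \<noteq> n - 1"
    then have kn: "k < n - 1" using k \<open>k \<noteq> n\<close> by auto
    define S where "S = {k..n}"
    have S: "S \<in> exact_coalitions" using wS k by (auto simp: S_def exact_coalitions_def)
    have "{1..<k} = {1..n} - S" using k by (auto simp: S_def)
    then have wL: "sum w {1..<k} = q - 1"
      using sum_weight_Diff[of S "{1..n}"] exactD[OF S] total_weight by auto
    have three: "w k + (w (n - 1) + w n) \<le> q"
    proof -
      have "sum w {k, n - 1, n} \<le> sum w S"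
        unfolding S_def using k kn by (intro sum_weight_mono) auto
      moreover have "sum w {k, n - 1, n} = w k + (w (n - 1) + w n)" using kn k by simp
      ultimately show ?thesis using exactD[OF S] by simp
    qed
    have wk: "1 \<le> w k" "1 \<le> w (n - 1)" using k kn weight_ge_1 by auto
    have "\<exists>l\<in>{1..<k}. sum w ({1..<k} \<inter> {l..}) = sum w {n}"
      using three wk wL k kn
      by (intro replace_by_lighter[OF S]) (auto simp: S_def intro!: weight_le)
    then obtain l where l: "l \<in> {1..<k}" "sum w ({1..<k} \<inter> {l..}) = w n" by auto
    define A where "A = {1..<k} \<inter> {l..}"
    define B where "B = S - {n} \<union> A"
    have A: "A \<subseteq> {1..<k}" "sum w A = w n" using l by (auto simp: A_def)
    have AN: "A \<subseteq> {1..n}" using A k by auto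
    have B: "B \<in> exact_coalitions"
      unfolding B_def using A AN k by (intro exact_swap[OF S]) (auto simp: S_def)
    have "sum w ({1..<k} - A) = q - 1 - w n"
      using sum_weight_Diff[of A "{1..<k}"] A wL \<open>{1..<k} = {1..n} - S\<close> by auto
    \<comment> \<open>The third member is what leaves room below \<open>k\<close> for both replacements.\<close>
    then have enough: "sum w {n - 1} \<le> sum w ({1..<k} - A)" using three wk by simp
    have "\<exists>m\<in>{1..<k} - A. sum w (({1..<k} - A) \<inter> {m..}) = sum w {n - 1}"
    proof (rule replace_by_lighter[OF B _ _ _ _ enough])
      fix p f assume p: "p \<in> B - {n - 1}" and f: "f \<in> {1..<k} - A"
      then have "f \<le> p" by (auto simp: B_def S_def A_def)
      then show "w f \<le> w p" using p f exactD(1)[OF B] k by (intro weight_le) auto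
    qed (use k kn in \<open>auto simp: B_def S_def\<close>)
    then obtain m where m: "sum w (({1..<k} - A) \<inter> {m..}) = w (n - 1)" by auto
    have "S = B"
      using m k kn A
      by (intro exchange_unique[OF card_exact S B, of "{n - 1}" "({1..<k} - A) \<inter> {m..}"])
         (auto simp: S_def B_def)
    moreover have "n \<in> S" "n \<notin> B" using k A by (auto simp: S_def B_def)
    ultimately show False by simp
  qed
  then have "{k..n} = {n - 1, n}" using n_gt_3 by auto
  then show ?thesis using wS n_gt_3 by simp
qed

text \<open>If \<open>w\<^sub>n = w\<^sub>n\<^sub>-\<^sub>1\<close>, these two players can be swapped in only one coalition containing \<open>n - 1\<close> and
  not \<open>n\<close>. It therefore coincides both with one containing player \<open>1\<close> and with \<open>n - 1\<close> together with
  a segment of heaviest players below. The segment thus reaches down to player \<open>1\<close>, which makes all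
  players below \<open>n - 1\<close> together as heavy as \<open>n\<close>; then \<open>q = 2\<close>, which is only possible for three
  players.\<close>

lemma top_strict: "w (n - 1) < w n"
proof (rule ccontr)
  define a where "a = w n"
  assume "\<not> w (n - 1) < w n"
  then have eq: "w (n - 1) = a" using weight_le[of "n - 1" n] n_gt_3 by (auto simp: a_def)
  then have q: "q = 2 * a" using top_pair by (simp add: a_def)
  define L where "L = {1..n - 2}"
  have N: "{1..n} = insert n (insert (n - 1) L)" using n_gt_3 by (auto simp: L_def)
  have LN: "L \<subseteq> {1..n}" and nL: "n \<notin> L" "n - 1 \<notin> L" "n \<noteq> n - 1"
    using n_gt_3 by (auto simp: L_def)
  have finL: "finite L" by (simp add: L_def)
  have wL: "sum w L = q - 1" using total_weight nL finL eq q unfolding N by (simp add: a_def)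
  define T where "T = {n - 1, n}"
  have T: "T \<in> exact_coalitions"
    using top_pair n_gt_3 by (auto simp: T_def exact_coalitions_def)
  obtain S where S: "S \<in> exact_coalitions" "1 \<in> S"
    using first_nondummy by (auto simp: exact_coalitions_def)
  have "\<exists>S. S \<in> exact_coalitions \<and> 1 \<in> S \<and> n - 1 \<in> S \<and> n \<notin> S"
  proof -
    have SN: "S \<subseteq> {1..n}" "sum w S = q" using exactD[OF S(1)] by auto
    have "\<not> (n - 1 \<in> S \<and> n \<in> S)"
    proof
      assume "n - 1 \<in> S \<and> n \<in> S"
      then have "T \<subset> S" using S n_gt_3 by (auto simp: T_def)
      then show False using sum_weight_psubset[of T S] SN exactD[OF T] by auto
    qed
    moreover have "n - 1 \<in> S \<or> n \<in> S"
    proof (rule ccontr)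
      assume "\<not> (n - 1 \<in> S \<or> n \<in> S)"
      then have "S \<subseteq> L" using SN N by auto
      then show False using sum_weight_mono[of S L] LN wL SN by auto
    qed
    moreover have "S - {n} \<union> {n - 1} \<in> exact_coalitions" if "n \<in> S" "n - 1 \<notin> S"
      using that eq n_gt_3 by (intro exact_swap[OF S(1)]) (auto simp: a_def)
    moreover have "1 \<in> S - {n} \<union> {n - 1}" "n - 1 \<in> S - {n} \<union> {n - 1}"
      "n \<notin> S - {n} \<union> {n - 1}"
      using S(2) n_gt_3 by auto
    ultimately show ?thesis using S by blast
  qed
  then obtain S where S: "S \<in> exact_coalitions" "1 \<in> S" "n - 1 \<in> S" "n \<notin> S" by blast
  have a1: "1 \<le> a" using weight_ge_1[of n] n_gt_3 by (simp add: a_def)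
  have "\<exists>l\<in>L. sum w (L \<inter> {l..}) = sum w {n}"
    using wL q a1 nL LN n_gt_3
    by (intro replace_by_lighter[OF T]) (auto simp: T_def a_def L_def intro!: weight_le)
  then obtain l where l: "l \<in> L" "sum w (L \<inter> {l..}) = a" by (auto simp: a_def)
  have "T - {n} \<union> L \<inter> {l..} \<in> exact_coalitions"
    using l nL LN by (intro exact_swap[OF T]) (auto simp: a_def T_def)
  then have "S = T - {n} \<union> L \<inter> {l..}"
    using S eq n_gt_3 nL
    by (intro exchange_unique[OF card_exact S(1), of _ "{n - 1}" "{n}"]) (auto simp: a_def T_def)
  then have "1 \<in> L \<inter> {l..}" using S n_gt_3 by (auto simp: T_def)
  then have "L \<inter> {l..} = L" by (auto simp: L_def)
  then have "a = 1" using l wL q by simp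
  moreover have "sum w {1, 2} \<le> sum w L" using n_gt_3 by (intro sum_weight_mono LN) (auto simp: L_def)
  then have "w 1 + w 2 \<le> sum w L" by simp
  moreover have "1 \<le> w 2" using weight_ge_1[of 2] n_gt_3 by simp
  ultimately show False using wL q weight_first by simp
qed

lemma type_pred_last: "ty (n - 1) = h - 1" and num_types_ge_2: "2 \<le> h"
  and top_type: "i \<in> {1..n} \<Longrightarrow> ty i = h \<Longrightarrow> i = n"
proof -
  have n1: "n - 1 \<in> {1..n}" "n \<in> {1..n}" using n_gt_3 by auto
  have lt: "ty (n - 1) < h" using type_less_iff[OF n1] top_strict type_last by simp
  show top: "i = n" if "i \<in> {1..n}" "ty i = h" for i
  proof (rule ccontr)
    assume "i \<noteq> n"
    then have "i \<le> n - 1" using that(1) by auto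
    then show False using type_mono[of i "n - 1"] that n1 lt by simp
  qed
  show "2 \<le> h" using lt type_bounds[OF n1(1)] by simp
  then have "1 \<le> h - 1" "h - 1 \<le> h" by linarith+
  then obtain i where i: "i \<in> {1..n}" "ty i = h - 1" using type_attained[of "h - 1"] by blast
  have "i \<noteq> n" using i type_last \<open>2 \<le> h\<close> by auto
  then have "i \<le> n - 1" using i(1) by auto
  then show "ty (n - 1) = h - 1" using type_mono[of i "n - 1"] i n1 lt by auto
qed

text \<open>The even types strictly above \<open>t = ty j\<close>, counted from \<open>t\<close>, form a losing coalition \<open>P\<close>; complete
  it greedily from the types up to \<open>t\<close>. The completion takes all of type \<open>t\<close>: if a member \<open>a\<close> were left
  out, the exchange of the last member \<open>k\<close> taken for \<open>a\<close> would fit both the completion and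
  \<open>{k} \<union> odd_above t\<close>.\<close>

lemma fill_even_types:
  assumes j: "j \<in> {1..n}" "ty j < h" and Q: "w j + sum w (odd_above (ty j)) = q"
  shows "sum w (even_above (ty j)) = q \<or>
    (\<exists>k\<in>types_below (ty j).
       sum w (even_above (ty j)) + sum w (types_below (ty j) \<inter> {k..}) = q)"
proof -
  define t where "t = ty j"
  define Od Ev L where "Od = odd_above t" and "Ev = even_above t" and "L = types_below t"
  note defs = Od_def Ev_def L_def odd_above_def even_above_def types_below_def
  define P where "P = {i \<in> Ev. t < ty i}"
  define F where "F = {i \<in> {1..n}. ty i \<le> t}"
  have sub: "P \<subseteq> {1..n}" "F \<subseteq> {1..n}" "Od \<subseteq> {1..n}" by (auto simp: P_def F_def defs)
  have "P \<union> F \<union> Od = {1..n}" by (auto simp: P_def F_def defs)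
  moreover have "sum w (P \<union> F \<union> Od) = sum w (P \<union> F) + sum w Od"
    using sub by (intro sum_weight_Un) (auto simp: P_def F_def defs)
  ultimately have "sum w {1..n} = sum w (P \<union> F) + sum w Od" by simp
  also have "sum w (P \<union> F) = sum w P + sum w F"
    using sub by (intro sum_weight_Un) (auto simp: P_def F_def)
  finally have tot: "sum w P + sum w F = q - 1 + w j"
    using total_weight Q by (simp add: Od_def t_def)
  have "w j \<le> sum w F" using j by (intro member_weight_le) (auto simp: F_def t_def)
  then have wP: "sum w P < q" using tot by simp
  have "\<exists>k\<in>F. sum w P + sum w (F \<inter> {k..}) = q"
  proof (rule greedy_fill)
    fix p f assume "p \<in> P" "f \<in> F"
    then have "ty f < ty p" "p \<in> {1..n}" "f \<in> {1..n}" by (auto simp: P_def F_def defs)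
    then show "w f \<le> w p" using type_less_iff[of f p] by simp
  qed (use sub wP tot weight_ge_1[OF j(1)] in \<open>auto simp: P_def F_def\<close>)
  then obtain k where k: "k \<in> F" "sum w P + sum w (F \<inter> {k..}) = q" by blast
  have kN: "k \<in> {1..n}" "ty k \<le> t" using k by (auto simp: F_def)
  define Y where "Y = P \<union> F \<inter> {k..}"
  have "P \<inter> (F \<inter> {k..}) = {}" by (auto simp: P_def F_def)
  then have "sum w Y = q"
    unfolding Y_def using k(2) sub sum_weight_Un[of P "F \<inter> {k..}"] by simp blast
  then have Y: "Y \<in> exact_coalitions" using sub by (auto simp: exact_coalitions_def Y_def)
  have whole: "k \<le> a" if a: "a \<in> {1..n}" "ty a = t" for a
  proof (rule ccontr)
    assume "\<not> k \<le> a"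
    then have ak: "a < k" by simp
    then have tk: "ty k = t" using type_mono[of a k] a kN by auto
    have "w k = w j" "w a = w k" using type_eq_iff a tk kN j by (auto simp: t_def)
    then have X: "insert k Od \<in> exact_coalitions"
      using Q sum_weight_insert[of Od k] sub kN tk
      by (auto simp: exact_coalitions_def t_def Od_def odd_above_def)
    have "Y = insert k Od"
      using a ak tk kN k \<open>w a = w k\<close>
      by (intro exchange_unique[OF card_exact Y X, of "{k}" "{a}"])
         (auto simp: Y_def P_def defs)
    moreover obtain i where "i \<in> {1..n}" "ty i = t + 1"
      using type_attained[of "t + 1"] j by (auto simp: t_def)
    then have "i \<in> Od" "i \<notin> Y" by (auto simp: Y_def P_def F_def defs)
    ultimately show False by auto
  qed
  have Ev_split: "Ev = P \<union> {i \<in> {1..n}. ty i = t}" by (auto simp: P_def defs)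
  show ?thesis
  proof (cases "k \<in> L")
    case True
    have "Y = Ev \<union> L \<inter> {k..}" using whole by (auto simp: Y_def Ev_split F_def L_def types_below_def)
    moreover have "sum w (Ev \<union> L \<inter> {k..}) = sum w Ev + sum w (L \<inter> {k..})"
      by (intro sum_weight_Un) (auto simp: defs)
    ultimately show ?thesis using True \<open>sum w Y = q\<close> by (auto simp: Ev_def L_def t_def)
  next
    case False
    then have tk: "ty k = t" using kN by (auto simp: L_def types_below_def)
    have "F \<inter> {k..} = {i \<in> {1..n}. ty i = t}"
      using whole type_mono[of k] tk kN by (force simp: F_def)
    then have "Y = Ev" by (simp add: Y_def Ev_split)
    then show ?thesis using \<open>sum w Y = q\<close> by (auto simp: Ev_def t_def)
  qed
qed

text \<open>The greedy completion of \<open>even_above t\<close> is its union with a top segment \<open>R\<close> of the lower types,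
  and the claim is that \<open>R\<close> is a single player \<open>c\<close>. Compare \<open>R\<close> with the top segment \<open>R'\<close> that
  replaces \<open>j\<close> in \<open>{j} \<union> odd_above t\<close>. Both have \<open>c\<close> as heaviest player, and the lower players outside
  \<open>R \<union> R'\<close> have total weight \<open>min (w(R)) (w(R')) - 1\<close> because the whole game has weight \<open>2 q - 1\<close>.
  Unless \<open>R = {c}\<close> this is at least \<open>w c\<close>, so \<open>c\<close> can be exchanged for some of them in two different
  coalitions.\<close>

lemma descend_type:
  assumes j: "j \<in> {1..n}" "1 < ty j" "ty j < h" and Q: "w j + sum w (odd_above (ty j)) = q"
    and i: "i \<in> {1..n}" "ty i = ty j - 1"
  shows "w i + sum w (odd_above (ty i)) = q"
proof -
  define t where "t = ty j"
  define Od Ev L where "Od = odd_above t" and "Ev = even_above t" and "L = types_below t"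
  note defs = Od_def Ev_def L_def odd_above_def even_above_def types_below_def
  have sub: "Od \<subseteq> {1..n}" "Ev \<subseteq> {1..n}" "L \<subseteq> {1..n}" by (auto simp: defs)
  have total: "sum w Od + sum w Ev + sum w L = 2 * q - 1"
    unfolding Od_def Ev_def L_def by (rule above_total)
  have Qt: "w j + sum w Od = q" using Q by (simp add: Od_def t_def)
  have finL: "finite L" using sub by (auto intro: finite_subset)
  have lighter: "w l \<le> w j - 1" if "l \<in> L" for l
    using that type_less_iff[of l j] j weight_Ints
    by (intro Ints_less_imp_le_diff_1) (auto simp: L_def types_below_def t_def)
  have light: "w l \<le> w p" if "l \<in> L" "p \<in> {1..n}" "t \<le> ty p" for l p
    using that type_less_iff[of l p] by (auto simp: L_def types_below_def)
  \<comment> \<open>If \<open>R\<close> were empty, all players of lower types together would weigh less than one of type \<open>t\<close>.\<close>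
  have "sum w Ev \<noteq> q"
  proof
    assume "sum w Ev = q"
    then have wL: "sum w L = w j - 1" using total Qt by simp
    define m where "m = (LEAST m. m \<in> {1..n} \<and> ty m = t)"
    have m: "m \<in> {1..n} \<and> ty m = t"
      unfolding m_def using j by (intro LeastI[of "\<lambda>m. m \<in> {1..n} \<and> ty m = t" j]) (simp add: t_def)
    have least: "\<not> (x \<in> {1..n} \<and> ty x = t)" if "x < m" for x
      using not_less_Least[of x] that unfolding m_def by blast
    have "L = {1..<m}"
    proof (rule equalityI; rule subsetI)
      fix x assume x: "x \<in> L"
      then have "\<not> m \<le> x" using type_mono[of m x] m by (auto simp: L_def types_below_def)
      then show "x \<in> {1..<m}" using x by (auto simp: L_def types_below_def)
    next
      fix x assume x: "x \<in> {1..<m}"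
      then show "x \<in> L" using least[of x] type_mono[of x m] m
        by (auto simp: L_def types_below_def)
    qed
    moreover have "m \<noteq> 1" using m type_first j by (auto simp: t_def)
    then have "w m \<le> sum w {1..<m}" using m by (intro weight_le_sum_of_lighter) auto
    moreover have "w m = w j" using type_eq_iff[of m j] m j by (auto simp: t_def)
    ultimately show False using wL by simp
  qed
  then obtain k where k: "k \<in> L" "sum w Ev + sum w (L \<inter> {k..}) = q"
    using fill_even_types[OF j(1,3) Q] by (auto simp: Ev_def L_def t_def)
  define R where "R = L \<inter> {k..}"
  have wR: "sum w Ev + sum w R = q" using k by (simp add: R_def)
  have wL: "sum w L = sum w R + w j - 1" using total Qt wR by simp
  have jO: "j \<notin> Od" "j \<in> Ev" using j by (auto simp: defs t_def)
  have X: "insert j Od \<in> exact_coalitions"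
    using sum_weight_insert[of Od j] sub jO j Qt by (auto simp: exact_coalitions_def)
  have "w k \<le> sum w R" using k sub by (intro member_weight_le) (auto simp: R_def)
  moreover have "1 \<le> w k" using k sub weight_ge_1 by auto
  ultimately have enough: "sum w {j} \<le> sum w L" using wL by simp
  have "\<exists>k'\<in>L. sum w (L \<inter> {k'..}) = sum w {j}"
  proof (rule replace_by_lighter[OF X _ _ sub(3) _ enough])
    show "insert j Od \<inter> L = {}" using jO by (auto simp: defs t_def)
    fix p f assume "p \<in> insert j Od - {j}" "f \<in> L"
    then show "w f \<le> w p" by (intro light) (auto simp: Od_def odd_above_def)
  qed auto
  then obtain k' where k': "k' \<in> L" "sum w (L \<inter> {k'..}) = w j" by auto
  define R' where "R' = L \<inter> {k'..}"
  have wR': "sum w R' = w j" using k' by (simp add: R'_def)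
  define c where "c = Max L"
  have cL: "c \<in> L" unfolding c_def using k finL by (intro Max_in) auto
  have cN: "c \<in> {1..n}" using cL sub by blast
  have cmax: "l \<le> c" if "l \<in> L" for l unfolding c_def using that finL by simp
  have cR: "c \<in> R" "c \<in> R'" using cL cmax k k' by (auto simp: R_def R'_def)
  have RL: "R \<subseteq> L" "R' \<subseteq> L" by (auto simp: R_def R'_def)
  have disj: "Ev \<inter> L = {}" "Od \<inter> L = {}" by (auto simp: defs)
  have RN: "R \<subseteq> {1..n}" "R' \<subseteq> {1..n}" "Ev \<inter> R = {}" "Od \<inter> R' = {}"
    using RL disj sub(3) by blast+
  have SE: "Ev \<union> R \<in> exact_coalitions" by (rule exact_Un[OF sub(2) RN(1,3) wR])
  have SO: "Od \<union> R' \<in> exact_coalitions"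
    using wR' Qt by (intro exact_Un sub(1) RN(2,4)) simp
  have distinct: "Ev \<union> R \<noteq> Od \<union> R'" using jO disj RL by blast
  have "R = {c}"
  proof (rule ccontr)
    assume "R \<noteq> {c}"
    then have "{c} \<subset> R" using cR by auto
    then have cR1: "w c + 1 \<le> sum w R" using sum_weight_psubset[of "{c}" R] sub by (auto simp: R_def)
    have cj: "w c + 1 \<le> w j" using lighter[OF cL] by simp
    \<comment> \<open>The lower players outside both segments.\<close>
    define D where "D = L \<inter> {..<min k k'}"
    have D: "D \<subseteq> L" "D \<subseteq> {1..n}" "D \<inter> R = {}" "D \<inter> R' = {}"
      using sub by (auto simp: D_def R_def R'_def)
    have DEO: "D \<inter> Ev = {}" "D \<inter> Od = {}" using D(1) disj by blast+
    have lightD: "w f \<le> w p" if "f \<in> D" "p \<in> (Ev \<union> R) \<union> (Od \<union> R')" for f p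
    proof (cases "p \<in> L")
      case True
      then have "p \<in> R \<union> R'" using that disj by blast
      then have "f \<le> p" using that by (auto simp: D_def R_def R'_def)
      then show ?thesis using that True D(2) sub by (intro weight_le) auto
    next
      case False
      then have "p \<in> Ev \<union> Od" using that RL by blast
      then have "p \<in> {1..n} \<and> t \<le> ty p" by (auto simp: defs)
      then show ?thesis using that D(1) by (intro light) auto
    qed
    have "\<exists>A\<subseteq>D. sum w A = sum w {c}"
    proof (cases "k \<le> k'")
      case True
      then have "D = L - R" by (auto simp: D_def R_def)
      then have wD: "sum w D = w j - 1" using sum_weight_Diff[OF RL(1) sub(3)] wL by simp
      have "\<exists>l\<in>D. sum w (D \<inter> {l..}) = sum w {c}"
        using D DEO cR wD cj by (intro replace_by_lighter[OF SE] lightD) auto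
      then show ?thesis by blast
    next
      case False
      then have "D = L - R'" by (auto simp: D_def R'_def)
      then have wD: "sum w D = sum w R - 1"
        using sum_weight_Diff[OF RL(2) sub(3)] wL wR' by simp
      have "\<exists>l\<in>D. sum w (D \<inter> {l..}) = sum w {c}"
        using D DEO cR wD cR1 by (intro replace_by_lighter[OF SO] lightD) auto
      then show ?thesis by blast
    qed
    then obtain A where A: "A \<subseteq> D" "sum w A = sum w {c}" by blast
    have "Ev \<union> R = Od \<union> R'"
      using A D DEO cR by (intro exchange_unique[OF card_exact SE SO, of "{c}" A]) auto
    then show False using distinct by simp
  qed
  then have "w c + sum w Ev = q" using wR by simp
  moreover have "w i = w c"
  proof -
    have "i \<in> L" using i j by (auto simp: L_def types_below_def t_def)
    then have "ty i \<le> ty c" by (intro type_mono i(1) cN cmax)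
    then have "ty i = ty c" using cL i by (auto simp: L_def types_below_def t_def)
    then show ?thesis using type_eq_iff[OF i(1) cN] by simp
  qed
  moreover have "odd_above (ty i) = Ev" using odd_above_pred[of t] i j by (simp add: Ev_def t_def)
  ultimately show ?thesis by simp
qed

text \<open>Descent from type \<open>h - 1\<close>, where \<open>S\<^sub>j\<close> has the weight of \<open>{n - 1, n}\<close>.\<close>

lemma weight_coalition_of_player:
  assumes i: "i \<in> {1..n}" "ty i < h"
  shows "w i + sum w (odd_above (ty i)) = q"
proof -
  have "\<forall>i\<in>{1..n}. ty i = h - d \<longrightarrow> w i + sum w (odd_above (ty i)) = q"
    if "1 \<le> d" "d < h" for d
    using that
  proof (induction d rule: dec_induct)
    case base
    show ?case
    proof (intro ballI impI)
      fix i assume i: "i \<in> {1..n}" "ty i = h - 1"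
      have "odd_above (h - 1) = even_above h" using num_types_ge_2 by (intro odd_above_pred) simp
      also have "\<dots> = {n}"
        using type_bounds top_type type_last n_gt_3 by (fastforce simp: even_above_def)
      finally have "odd_above (ty i) = {n}" using i by simp
      moreover have "w i = w (n - 1)"
        using type_eq_iff[of i "n - 1"] i type_pred_last n_gt_3 by auto
      ultimately show "w i + sum w (odd_above (ty i)) = q" using top_pair by simp
    qed
  next
    case (step d)
    show ?case
    proof (intro ballI impI)
      fix i assume i: "i \<in> {1..n}" "ty i = h - Suc d"
      obtain j where j: "j \<in> {1..n}" "ty j = h - d" using type_attained[of "h - d"] step.hyps step.prems
        by (auto simp: Suc_le_eq)
      show "w i + sum w (odd_above (ty i)) = q"
        using i j step by (intro descend_type[of j i]) auto
    qed
  qed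
  from this[of "h - ty i"] show ?thesis using i type_bounds[OF i(1)] by auto
qed

lemma weight_odd_types: "sum w (even_above 1) = q"
proof -
  have "types_below (ty 1) = {}" using type_bounds type_first by (fastforce simp: types_below_def)
  moreover have "1 \<in> {1..n}" "ty 1 < h" using n_gt_3 type_first num_types_ge_2 by auto
  ultimately show ?thesis
    using fill_even_types[of 1] weight_coalition_of_player[of 1] type_first by auto
qed

section \<open>The determinant\<close>

text \<open>Rows \<open>n\<close> and \<open>j\<close> apart, the rows with entry \<open>1\<close> in column \<open>j\<close> are those of \<open>odd_below (ty j)\<close>.\<close>

definition odd_below :: "nat \<Rightarrow> nat set" where
  "odd_below t = {i \<in> {1..n}. ty i < t \<and> odd (t - ty i)}"

text \<open>The types at odd distance from \<open>t\<close> are the even ones or the odd ones. The former weigh \<open>q - 1\<close>, as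
  they make up \<open>S\<^sub>1\<close> without player \<open>1\<close>; the latter weigh \<open>q\<close>, as they make up \<open>S\<^sub>n\<close>.\<close>

lemma weight_odd_below:
  assumes t: "1 \<le> t"
  shows "sum w (odd_below t) = q - sum w (odd_above t) - of_bool (odd t)"
proof -
  have "odd_below t \<inter> odd_above t = {}" by (auto simp: odd_below_def odd_above_def)
  moreover have "odd_below t \<subseteq> {1..n}" by (auto simp: odd_below_def)
  ultimately have un:
    "sum w (odd_below t \<union> odd_above t) = sum w (odd_below t) + sum w (odd_above t)"
    by (intro sum_weight_Un above_subset)
  have mem: "i \<in> odd_below t \<union> odd_above t \<longleftrightarrow> i \<in> {1..n} \<and> odd (ty i + t)" for i
    by (cases "ty i = t") (auto simp: odd_below_def odd_above_def)
  show ?thesis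
  proof (cases "odd t")
    case True
    have "odd_below t \<union> odd_above t = odd_above 1"
      unfolding set_eq_iff mem using type_bounds True
      by (fastforce simp: odd_above_def elim: oddE)
    moreover have "w 1 + sum w (odd_above 1) = q"
      using weight_coalition_of_player[of 1] n_gt_3 type_first num_types_ge_2 by simp
    ultimately show ?thesis using un True weight_first by simp
  next
    case False
    have "odd_below t \<union> odd_above t = even_above 1"
      unfolding set_eq_iff mem using type_bounds False
      by (fastforce simp: even_above_def)
    then show ?thesis using un False weight_odd_types by simp
  qed
qed

lemma mem_mw_coalition:
  assumes "i \<in> {1..n}" "j \<in> {1..n}"
  shows "j \<in> mw_coalition n w i \<longleftrightarrow>
    (if i = n then odd (ty j) else j = i \<or> i \<in> odd_below (ty j))"
  using assms by (auto simp: mw_coalition_def odd_below_def)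

text \<open>All of \<open>odd_below (ty j)\<close> enters with the sign opposite to that of \<open>j\<close>. For \<open>j < n\<close> the sum is
  \<open>\<plusminus> (w j - w(odd_below (ty j)))\<close> plus the entry of row \<open>n\<close>, and the equation \<open>w(S\<^sub>j) = q\<close> makes it
  vanish; for \<open>j = n\<close> the term \<open>w j\<close> is missing and \<open>q\<close> survives.\<close>

lemma signed_column_sum:
  assumes j: "j \<in> {1..n}"
  shows "(\<Sum>i = 1..<n. (-1) ^ ty i * w i * of_bool (j \<in> mw_coalition n w i)) + of_bool (odd (ty j))
    = (if j = n then q * (-1) ^ (h + 1) else 0)"
proof -
  define B where "B = odd_below (ty j)"
  have B: "B \<subseteq> {1..<n}"
  proof
    fix i assume "i \<in> B"
    then have i: "i \<in> {1..n}" "ty i < ty j" by (auto simp: B_def odd_below_def)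
    then show "i \<in> {1..<n}" using type_bounds[OF j] type_last by (cases "i = n") auto
  qed
  have finB: "finite B" using B by (rule finite_subset) simp
  have jB: "j \<notin> B" by (simp add: B_def odd_below_def)
  have "(\<Sum>i = 1..<n. (-1) ^ ty i * w i * of_bool (j \<in> mw_coalition n w i)) =
      (\<Sum>i = 1..<n. (-1) ^ ty i * w i * of_bool (i = j) + (-1) ^ ty i * w i * of_bool (i \<in> B))"
    using j jB mem_mw_coalition[of _ j] by (intro sum.cong) (auto simp: B_def)
  also have "\<dots> = (\<Sum>i = 1..<n. (-1) ^ ty i * w i * of_bool (i = j)) +
      (\<Sum>i = 1..<n. (-1) ^ ty i * w i * of_bool (i \<in> B))"
    by (rule sum.distrib)
  also have "(\<Sum>i = 1..<n. (-1) ^ ty i * w i * of_bool (i = j)) =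
      (if j = n then 0 else (-1) ^ ty j * w j)"
    using j by (auto simp: of_bool_def if_distrib[of "\<lambda>x. _ * x"] cong: if_cong)
  also have "(\<Sum>i = 1..<n. (-1) ^ ty i * w i * of_bool (i \<in> B)) = (\<Sum>i\<in>B. (-1) ^ ty i * w i)"
    using B by (intro sum.mono_neutral_cong_right) auto
  also have "\<dots> = (\<Sum>i\<in>B. - ((-1) ^ ty j) * w i)"
  proof (rule sum.cong)
    fix i assume "i \<in> B"
    then have "odd (ty i) \<longleftrightarrow> even (ty j)" by (auto simp: B_def odd_below_def)
    then show "(-1) ^ ty i * w i = - ((-1) ^ ty j) * w i" by (cases "even (ty j)") auto
  qed simp
  also have "\<dots> = - ((-1) ^ ty j) * sum w B" by (simp add: sum_distrib_left)
  finally have *: "(\<Sum>i = 1..<n. (-1) ^ ty i * w i * of_bool (j \<in> mw_coalition n w i)) =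
      (if j = n then 0 else (-1) ^ ty j * w j) - (-1) ^ ty j * sum w B" by simp
  have wB: "sum w B = q - sum w (odd_above (ty j)) - of_bool (odd (ty j))"
    unfolding B_def using type_bounds[OF j] by (intro weight_odd_below) simp
  show ?thesis
  proof (cases "j = n")
    case True
    have "odd_above h = {}" using type_bounds by (force simp: odd_above_def)
    then show ?thesis using * wB True type_last by (cases "odd h") auto
  next
    case False
    then have "ty j \<noteq> h" using top_type[of j] j by auto
    then have "w j + sum w (odd_above (ty j)) = q"
      using weight_coalition_of_player[of j] type_bounds[OF j] j by auto
    then have "sum w B = w j - of_bool (odd (ty j))" using wB by simp
    then show ?thesis using * False by (cases "odd (ty j)") auto
  qed
qed

lemma det_incidence_matrix: "det (incidence_matrix n w) = q * (-1) ^ (h + 1)"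
proof -
  define A where "A = incidence_matrix n w"
  \<comment> \<open>Left multiplication by \<open>N\<close> adds the signed multiples of the other rows to the last one.\<close>
  define N :: "real mat" where "N = mat n n (\<lambda>(i, j).
    if i = n - 1 then (if j = n - 1 then 1 else (-1) ^ ty (Suc j) * w (Suc j)) else of_bool (i = j))"
  have A: "A \<in> carrier_mat n n" by (simp add: A_def incidence_matrix_def)
  have N: "N \<in> carrier_mat n n" by (simp add: N_def)
  have a: "A $$ (i, j) = of_bool (Suc j \<in> mw_coalition n w (Suc i))" if "i < n" "j < n" for i j
    using that by (simp add: A_def incidence_matrix_def)
  have "det N = prod_list (diag_mat N)"
    by (rule det_lower_triangular[OF _ N]) (auto simp: N_def)
  also have "\<dots> = 1" using N by (auto simp: prod_list_diag_prod N_def intro!: prod.neutral)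
  finally have detN: "det N = 1" .
  have NA: "N * A \<in> carrier_mat n n" using N A by simp
  have upper: "(N * A) $$ (i, j) = A $$ (i, j)" if "i < n - 1" "j < n" for i j
  proof -
    have "(N * A) $$ (i, j) = (\<Sum>k = 0..<n. of_bool (i = k) * A $$ (k, j))"
      using that N A by (auto simp: N_def scalar_prod_def intro!: sum.cong)
    also have "\<dots> = A $$ (i, j)" using that by (simp add: of_bool_def if_distrib[of "\<lambda>x. x * _"] cong: if_cong)
    finally show ?thesis .
  qed
  have last: "(N * A) $$ (n - 1, j) = (if j = n - 1 then q * (-1) ^ (h + 1) else 0)" if j: "j < n" for j
  proof -
    have "(N * A) $$ (n - 1, j) = (\<Sum>k = 0..<n. N $$ (n - 1, k) * A $$ (k, j))"
      using j N A n_gt_3 by (auto simp: scalar_prod_def intro!: sum.cong)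
    also have "\<dots> = (\<Sum>k = 0..<n - 1. N $$ (n - 1, k) * A $$ (k, j)) + A $$ (n - 1, j)"
      using n_gt_3 sum.atLeast0_lessThan_Suc[of "\<lambda>k. N $$ (n - 1, k) * A $$ (k, j)" "n - 1"]
      by (simp add: N_def)
    also have "A $$ (n - 1, j) = of_bool (odd (ty (Suc j)))"
      using a[of "n - 1" j] j n_gt_3 mem_mw_coalition[of n "Suc j"] by simp
    also have "(\<Sum>k = 0..<n - 1. N $$ (n - 1, k) * A $$ (k, j)) =
        (\<Sum>i = 1..<n. (-1) ^ ty i * w i * of_bool (Suc j \<in> mw_coalition n w i))"
      using j a by (intro sum.reindex_bij_witness[of _ "\<lambda>i. i - 1" Suc]) (auto simp: N_def)
    finally show ?thesis using signed_column_sum[of "Suc j"] j n_gt_3 by auto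
  qed
  have "det (N * A) = prod_list (diag_mat (N * A))"
  proof (rule det_upper_triangular[OF _ NA])
    show "upper_triangular (N * A)"
    proof (rule upper_triangularI)
      fix i j assume "j < i" "i < dim_row (N * A)"
      then have ij: "j < i" "i < n" using NA by auto
      show "(N * A) $$ (i, j) = 0"
      proof (cases "i = n - 1")
        case True
        then show ?thesis using last[of j] ij by simp
      next
        case False
        have "Suc j \<notin> mw_coalition n w (Suc i)"
          using type_mono[of "Suc j" "Suc i"] mem_mw_coalition[of "Suc i" "Suc j"] ij False
          by (auto simp: odd_below_def)
        then show ?thesis using upper[of i j] a[of i j] ij False by simp
      qed
    qed
  qed
  also have "\<dots> = (\<Prod>i = 0..<n. (N * A) $$ (i, i))" using N A by (simp add: prod_list_diag_prod)
  also have "\<dots> = (\<Prod>i = 0..<n - 1. (N * A) $$ (i, i)) * (N * A) $$ (n - 1, n - 1)"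
    using n_gt_3 prod.atLeast0_lessThan_Suc[of "\<lambda>k. (N * A) $$ (k, k)" "n - 1"] by simp
  also have "(\<Prod>i = 0..<n - 1. (N * A) $$ (i, i)) = 1"
    using mem_mw_coalition by (intro prod.neutral) (auto simp: upper a)
  finally show ?thesis using det_mult[OF N A] detN last[of "n - 1"] n_gt_3 by (simp add: A_def)
qed

end

section \<open>From games to weights\<close>

lemma minimal_winning_iff_exact:
  assumes "simple_game n v" "homogeneous_representation n v q w"
  shows "minimal_winning n v S \<longleftrightarrow> S \<subseteq> {1..n} \<and> sum w S = q"
proof
  assume "minimal_winning n v S"
  then show "S \<subseteq> {1..n} \<and> sum w S = q"
    using assms by (auto simp: homogeneous_representation_def minimal_winning_def)
next
  assume S: "S \<subseteq> {1..n} \<and> sum w S = q"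
  have rep: "\<And>X. X \<subseteq> {1..n} \<Longrightarrow> v X = 1 \<longleftrightarrow> q \<le> sum w X" "\<And>j. j \<in> {1..n} \<Longrightarrow> 0 < w j"
    using assms by (auto simp: homogeneous_representation_def representation_def)
  have "v T = 0" if T: "T \<subset> S" for T
  proof -
    have "sum w T < sum w S"
    proof -
      obtain x where "x \<in> S - T" using T by blast
      then show ?thesis using T S rep(2)
        by (intro sum_strict_mono2[of S T x]) (auto intro: finite_subset intro!: less_imp_le[OF rep(2)])
    qed
    moreover have "T \<subseteq> {1..n}" using T S by auto
    ultimately show ?thesis using rep(1)[of T] S assms(1) by (auto simp: simple_game_def)
  qed
  then show "minimal_winning n v S" using S rep(1)[of S] by (auto simp: minimal_winning_def)
qed

lemma P_game_parsimonious_weights: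
  assumes P: "P_game n v" and min: "minimal_homogeneous_representation n v q w"
    and mono: "mono_on {1..n} w"
  shows "parsimonious_weights n w q"
proof -
  have hom: "homogeneous_representation n v q w" and q: "q = (1 + sum w {1..n}) / 2"
    and ints: "\<And>j. j \<in> {1..n} \<Longrightarrow> w j \<in> \<int>" and Min: "Min (w ` {1..n}) = 1"
    using min by (auto simp: minimal_homogeneous_representation_def)
  have n: "3 < n" and simple: "simple_game n v" using P by (auto simp: P_game_def)
  have mw: "minimal_winning n v S \<longleftrightarrow> S \<subseteq> {1..n} \<and> sum w S = q" for S
    by (rule minimal_winning_iff_exact[OF simple hom])
  have rep: "\<And>X. X \<subseteq> {1..n} \<Longrightarrow> v X = 1 \<longleftrightarrow> q \<le> sum w X"
    using hom by (auto simp: homogeneous_representation_def representation_def)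
  have ge1: "1 \<le> w j" if "j \<in> {1..n}" for j
    using Min_le[OF _ imageI[OF that], of w] Min by simp
  have w1: "w 1 = 1"
  proof -
    have "Min (w ` {1..n}) \<in> w ` {1..n}" using n by (intro Min_in) auto
    then obtain j where "j \<in> {1..n}" "w j = 1" using Min by auto
    then show ?thesis using mono_onD[OF mono, of 1 j] ge1[of 1] n by auto
  qed
  \<comment> \<open>A winning coalition contains a minimal winning one, whose weight is \<open>q\<close>.\<close>
  have exact_sub: "\<exists>Y\<subseteq>X. sum w Y = q" if X: "X \<subseteq> {1..n}" "q \<le> sum w X" for X
  proof -
    have "finite X" using X(1) by (rule finite_subset) simp
    then have "finite {Y. Y \<subseteq> X \<and> q \<le> sum w Y}" by simp
    from finite_has_minimal2[OF this, of X] X obtain Y where Y: "Y \<subseteq> X" "q \<le> sum w Y"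
      and least: "\<And>Z. Z \<subseteq> X \<Longrightarrow> q \<le> sum w Z \<Longrightarrow> Z \<subseteq> Y \<Longrightarrow> Y = Z" by auto
    have "v T = 0" if T: "T \<subset> Y" for T
    proof -
      have TN: "T \<subseteq> {1..n}" "T \<subseteq> X" using T Y X by auto
      then have "\<not> q \<le> sum w T" using least[of T] T by auto
      then show ?thesis using rep[of T] TN simple by (auto simp: simple_game_def)
    qed
    then have "minimal_winning n v Y" using Y X rep[of Y] by (auto simp: minimal_winning_def)
    then show ?thesis using mw Y by auto
  qed
  have hw: "homogeneous_weights n w q"
  proof
    have "\<not> dummy n v 1" using P n by (auto simp: P_game_def)
    then show "\<exists>S\<subseteq>{1..n}. sum w S = q \<and> 1 \<in> S" unfolding dummy_def mw by blast
    show "1 \<le> n" "sum w {1..n} = 2 * q - 1" using n q by simp_all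
  qed (fact mono ints ge1 w1 exact_sub)+
  show ?thesis
  proof (intro parsimonious_weights.intro parsimonious_weights_axioms.intro hw n)
    fix j assume j: "j \<in> {1..n}"
    then have "v {j} \<noteq> 1" using P by (auto simp: P_game_def dictator_def)
    then show "w j < q" using rep[of "{j}"] j by auto
  next
    have "homogeneous_weights.exact_coalitions n w q = {S. minimal_winning n v S}"
      using mw by (auto simp: homogeneous_weights.exact_coalitions_def[OF hw])
    then show "card (homogeneous_weights.exact_coalitions n w q) = n"
      using P by (simp add: P_game_def)
  qed
qed

theorem theorem4p2:
  fixes n h :: nat and v :: "nat set \<Rightarrow> nat" and q :: real and w :: "nat \<Rightarrow> real"
    and A :: "real mat"
  assumes "P_game n v"
    and "minimal_homogeneous_representation n v q w"
    and "mono_on {1..n} w"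
    and "h = num_types n w"
    and "A = incidence_matrix n w"
  shows "invertible_mat A \<and> det A = q * (-1) ^ (h + 1)"
proof -
  interpret parsimonious_weights n w q
    using assms(1-3) by (rule P_game_parsimonious_weights)
  have det: "det A = q * (-1) ^ (h + 1)" using det_incidence_matrix assms(4,5) by simp
  moreover have A: "A \<in> carrier_mat n n" using assms(5) by (simp add: incidence_matrix_def)
  ultimately have "A \<in> Units (ring_mat TYPE(real) n ())"
    using quota_pos by (intro det_non_zero_imp_unit) auto
  then obtain B where "B \<in> carrier_mat n n" "B * A = 1\<^sub>m n" "A * B = 1\<^sub>m n"
    by (auto simp: Units_def ring_mat_simps)
  then have "invertible_mat A"
    using A by (auto simp: invertible_mat_def inverts_mat_def)
  then show ?thesis using det by simp
qed

end
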